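(* Let $(V,Y,\mathbf 1)$ be a vertex algebra (with vacuum). Let $W$ be a vector space equipped with a linear map $Y_W(\cdot,x):V\to(\mathrm{End}\,W)[[x,x^{-1}]]$, $v\mapsto Y_W(v,x)=\sum_{n\in\mathbb Z}v_nx^{-n-1}$, satisfying the minor axioms of a module: $Y_W(u,x)w\in W((x))$ for all $u\in V$, $w\in W$, and $Y_W(\mathbf 1,x)=1$ (the identity operator on $W$). Then the following are equivalent: (1) (Jacobi identity) for all $u,v\in V$, $w\in W$, $$x_0^{-1}\delta\left(\frac{x_1-x_2}{x_0}\right)Y_W(u,x_1)Y_W(v,x_2)w-x_0^{-1}\delta\left(\frac{-x_2+x_1}{x_0}\right)Y_W(v,x_2)Y_W(u,x_1)w=x_1^{-1}\delta\left(\frac{x_2+x_0}{x_1}\right)Y_W(Y(u,x_0)v,x_2)w;$$ (2) (weak associativity) for all $u,v\in V$, $w\in W$ there exists an integer $m\ge 0$ such that $$(x_0+x_2)^m\left(Y_W(u,x_0+x_2)Y_W(v,x_2)w-Y_W(Y(u,x_0)v,x_2)w\right)=0;$$ (3) (weak skew-associativity) for all $u,v\in V$, $w\in W$ there exists an integer $m\ge 0$ such that $$(x_1-x_0)^m\left(Y_W(v,-x_0+x_1)Y_W(u,x_1)w-Y_W(Y(u,x_0)v,x_1-x_0)w\right)=0.$$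
   Context: All vector spaces are over $\mathbb C$; formal variables commute. For a vector space $U$, $U[[x,x^{-1}]]$ is the space of all formal Laurent series $\sum_{n\in\mathbb Z}u_nx^n$ with $u_n\in U$; $U((x))$ is the subspace of series with $u_n=0$ for $n$ sufficiently negative; $U[[x]]$ is the space of formal power series. $\delta(x)=\sum_{n\in\mathbb Z}x^n$. Binomial expansion convention: for every $n\in\mathbb Z$, $(x+y)^n=\sum_{k\ge0}\binom nk x^{n-k}y^k$, i.e. binomials are expanded in nonnegative powers of the second-listed variable (likewise with signs, so $(x_1-x_2)^n$ is expanded in nonnegative powers of $x_2$ and $(-x_2+x_1)^n$ in nonnegative powers of $x_1$); this applies inside $\delta$ and to substitutions such as $F(x+y)$. Vertex operator maps are extended coefficientwise to series: $Y_W(Y(u,x_0)v,x_2)=\sum_n Y_W(u_nv,x_2)x_0^{-n-1}$. A vertex algebra is a vector space $V$ with a linear map $Y(\cdot,x):V\to(\mathrm{End}\,V)[[x,x^{-1}]]$, $v\mapsto Y(v,x)=\sum_{n\in\mathbb Z}v_nx^{-n-1}$, and a distinguished vector $\mathbf 1\in V$, such that: $Y(\cdot,x)$ is injective; $Y(u,x)v\in V((x))$ for all $u,v\in V$; the Jacobi identity holds for all $u,v\in V$: $$x_0^{-1}\delta\left(\tfrac{x_1-x_2}{x_0}\right)Y(u,x_1)Y(v,x_2)-x_0^{-1}\delta\left(\tfrac{-x_2+x_1}{x_0}\right)Y(v,x_2)Y(u,x_1)=x_1^{-1}\delta\left(\tfrac{x_2+x_0}{x_1}\right)Y(Y(u,x_0)v,x_2);$$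 $Y(\mathbf 1,x)=1$ (vacuum property); and $Y(u,x)\mathbf 1\in V[[x]]$ with $Y(u,0)\mathbf 1=u$ for all $u\in V$ (creation property). A module for $V$ is a vector space $W$ with a map $Y_W$ satisfying the minor axioms stated in the claim together with the Jacobi identity (1). *)

theory Defs
  imports Complex_Main "HOL-Library.Groups_Big_Fun" "HOL-Library.Product_Plus"
begin

text \<open>
  A formal series with coefficients in \<open>'u\<close> is the function sending an exponent to its coefficient:
  exponents are \<open>int\<close> in one variable and tuples of integers in several variables.
  No restriction on the support is imposed, so \<open>int \<Rightarrow> 'u\<close> is \<open>U[[x,x\<^sup>-\<^sup>1]]\<close>.

  A map \<open>Y(\<cdot>,x)\<close> is given by its modes: \<open>Y v n\<close> is the operator \<open>v\<^sub>n\<close>, that is, the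
  coefficient of \<open>x\<^bsup>-n-1\<^esup>\<close> in \<open>Y(v,x)\<close>.
\<close>

definition laurent :: "(int \<Rightarrow> 'u::zero) \<Rightarrow> bool" where
  "laurent F \<longleftrightarrow> (\<exists>N. \<forall>n<N. F n = 0)"

definition power_series :: "(int \<Rightarrow> 'u::zero) \<Rightarrow> bool" where
  "power_series F \<longleftrightarrow> (\<forall>n<0. F n = 0)"

text \<open>
  Product of a scalar series and a vector series. \<open>Sum_any\<close> is the sum over the support of the
  summand, and is \<open>0\<close> when that support is infinite. Under the truncation condition
  \<open>Y(u,x)w \<in> W((x))\<close> (for the algebra and for the module) the support is finite in every use
  below, here and in \<open>subst_binomial\<close>.
\<close>

definition series_mult ::
    "(complex \<Rightarrow> 'u \<Rightarrow> 'u) \<Rightarrow> ('e \<Rightarrow> complex) \<Rightarrow> ('e \<Rightarrow> 'u) \<Rightarrow> 'e::ab_group_add \<Rightarrow> 'u::ab_group_add" where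
  "series_mult s F G e = (\<Sum>d. s (F d) (G (e - d)))"

text \<open>
  The coefficient of \<open>x\<^sup>i y\<^sup>j\<close> in \<open>(a x + b y)\<^sup>n = (\<Sum>k\<ge>0. (n choose k) (a x)\<^bsup>n-k\<^esup> (b y)\<^sup>k)\<close>,
  expanded in nonnegative powers of the second-listed variable \<open>y\<close>. Used with \<open>a, b = \<plusminus>1\<close>.
\<close>

definition binomial_expansion :: "complex \<Rightarrow> complex \<Rightarrow> int \<Rightarrow> int \<times> int \<Rightarrow> complex" where
  "binomial_expansion a b n = (\<lambda>(i, j).
     if 0 \<le> j \<and> i + j = n then (of_int n gchoose nat j) * a powi i * b ^ nat j else 0)"

text \<open>
  The coefficient of \<open>z\<^sup>h x\<^sup>i y\<^sup>j\<close> in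
  \<open>z\<^sup>-\<^sup>1 \<delta>((a x + b y) / z) = (\<Sum>n\<in>\<int>. z\<^bsup>-n-1\<^esup> (a x + b y)\<^sup>n)\<close>; only \<open>n = -h-1\<close> contributes.
\<close>

definition delta_expansion :: "complex \<Rightarrow> complex \<Rightarrow> int \<times> int \<times> int \<Rightarrow> complex" where
  "delta_expansion a b = (\<lambda>(h, i, j). binomial_expansion a b (- h - 1) (i, j))"

text \<open>
  \<open>F(a x + b y, y) = (\<Sum>p q. F\<^sub>p\<^sub>q (a x + b y)\<^sup>p y\<^sup>q)\<close>, as a series in \<open>(x, y)\<close>.
\<close>

definition subst_binomial ::
    "(complex \<Rightarrow> 'u \<Rightarrow> 'u) \<Rightarrow> complex \<Rightarrow> complex \<Rightarrow> (int \<times> int \<Rightarrow> 'u) \<Rightarrow> int \<times> int \<Rightarrow> 'u::ab_group_add" where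
  "subst_binomial s a b F = (\<lambda>(i, j). \<Sum>(p, q). s (binomial_expansion a b p (i, j - q)) (F (p, q)))"

definition op_series :: "('v \<Rightarrow> int \<Rightarrow> 'w \<Rightarrow> 'w) \<Rightarrow> 'v \<Rightarrow> 'w \<Rightarrow> int \<Rightarrow> 'w" where
  "op_series Y u w i = Y u (- i - 1) w"

text \<open>\<open>Y\<^sub>W(u,x) Y\<^sub>W(v,y) w\<close> as a series in \<open>(x, y)\<close>.\<close>

definition product_series ::
    "('v \<Rightarrow> int \<Rightarrow> 'w \<Rightarrow> 'w) \<Rightarrow> 'v \<Rightarrow> 'v \<Rightarrow> 'w \<Rightarrow> int \<times> int \<Rightarrow> 'w" where
  "product_series YW u v w = (\<lambda>(i, j). op_series YW u (op_series YW v w j) i)"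

text \<open>\<open>Y\<^sub>W(Y(u,x\<^sub>0)v, x) w\<close> as a series in \<open>(x\<^sub>0, x)\<close>.\<close>

definition iterate_series ::
    "('v \<Rightarrow> int \<Rightarrow> 'v \<Rightarrow> 'v) \<Rightarrow> ('v \<Rightarrow> int \<Rightarrow> 'w \<Rightarrow> 'w) \<Rightarrow> 'v \<Rightarrow> 'v \<Rightarrow> 'w \<Rightarrow> int \<times> int \<Rightarrow> 'w" where
  "iterate_series Y YW u v w = (\<lambda>(i, j). op_series YW (op_series Y u v i) w j)"

text \<open>
  The two sides are series in \<open>(x\<^sub>0, x\<^sub>1, x\<^sub>2)\<close>; a series not involving one of the variables is
  concentrated in exponent \<open>0\<close> of that variable.
\<close>

definition jacobi_identity ::
    "(complex \<Rightarrow> 'w \<Rightarrow> 'w) \<Rightarrow> ('v \<Rightarrow> int \<Rightarrow> 'v \<Rightarrow> 'v) \<Rightarrow> ('v \<Rightarrow> int \<Rightarrow> 'w \<Rightarrow> 'w)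
      \<Rightarrow> 'v \<Rightarrow> 'v \<Rightarrow> 'w::ab_group_add \<Rightarrow> bool" where
  "jacobi_identity sW Y YW u v w \<longleftrightarrow>
    (\<forall>e. series_mult sW (\<lambda>(i0, i1, i2). delta_expansion 1 (-1) (i0, i1, i2))
            (\<lambda>(i0, i1, i2). if i0 = 0 then product_series YW u v w (i1, i2) else 0) e
        - series_mult sW (\<lambda>(i0, i1, i2). delta_expansion (-1) 1 (i0, i2, i1))
            (\<lambda>(i0, i1, i2). if i0 = 0 then product_series YW v u w (i2, i1) else 0) e
        = series_mult sW (\<lambda>(i0, i1, i2). delta_expansion 1 1 (i1, i2, i0))
            (\<lambda>(i0, i1, i2). if i1 = 0 then iterate_series Y YW u v w (i0, i2) else 0) e)"

text \<open>Series in \<open>(x\<^sub>0, x\<^sub>2)\<close>.\<close>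

definition weak_associativity ::
    "(complex \<Rightarrow> 'w \<Rightarrow> 'w) \<Rightarrow> ('v \<Rightarrow> int \<Rightarrow> 'v \<Rightarrow> 'v) \<Rightarrow> ('v \<Rightarrow> int \<Rightarrow> 'w \<Rightarrow> 'w)
      \<Rightarrow> 'v \<Rightarrow> 'v \<Rightarrow> 'w::ab_group_add \<Rightarrow> nat \<Rightarrow> bool" where
  "weak_associativity sW Y YW u v w m \<longleftrightarrow>
    (\<forall>e. series_mult sW (\<lambda>(i0, i2). binomial_expansion 1 1 (int m) (i0, i2))
          (\<lambda>(i0, i2). subst_binomial sW 1 1 (product_series YW u v w) (i0, i2)
                      - iterate_series Y YW u v w (i0, i2)) e = 0)"

text \<open>
  Series in \<open>(x\<^sub>0, x\<^sub>1)\<close>. As \<open>x\<^sub>1\<close> is listed first in \<open>x\<^sub>1 - x\<^sub>0\<close>, the arguments are swapped there.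
\<close>

definition weak_skew_associativity ::
    "(complex \<Rightarrow> 'w \<Rightarrow> 'w) \<Rightarrow> ('v \<Rightarrow> int \<Rightarrow> 'v \<Rightarrow> 'v) \<Rightarrow> ('v \<Rightarrow> int \<Rightarrow> 'w \<Rightarrow> 'w)
      \<Rightarrow> 'v \<Rightarrow> 'v \<Rightarrow> 'w::ab_group_add \<Rightarrow> nat \<Rightarrow> bool" where
  "weak_skew_associativity sW Y YW u v w m \<longleftrightarrow>
    (\<forall>e. series_mult sW (\<lambda>(i0, i1). binomial_expansion 1 (-1) (int m) (i1, i0))
          (\<lambda>(i0, i1). subst_binomial sW (-1) 1 (product_series YW v u w) (i0, i1)
                      - subst_binomial sW 1 (-1) (\<lambda>(i, j). iterate_series Y YW u v w (j, i)) (i1, i0)) e = 0)"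

text \<open>Linearity of \<open>Y\<^sub>W(\<cdot>,x) : V \<rightarrow> (End W)[[x,x\<^sup>-\<^sup>1]]\<close>.\<close>

definition linear_vertex_map ::
    "(complex \<Rightarrow> 'v \<Rightarrow> 'v) \<Rightarrow> (complex \<Rightarrow> 'w \<Rightarrow> 'w)
      \<Rightarrow> ('v::ab_group_add \<Rightarrow> int \<Rightarrow> 'w \<Rightarrow> 'w::ab_group_add) \<Rightarrow> bool" where
  "linear_vertex_map sV sW YW \<longleftrightarrow>
    (\<forall>v n. Vector_Spaces.linear sW sW (YW v n)) \<and>
    (\<forall>n w. Vector_Spaces.linear sV sW (\<lambda>v. YW v n w))"

locale vertex_algebra = vector_space sV
  for sV :: "complex \<Rightarrow> 'v \<Rightarrow> 'v::ab_group_add" +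
  fixes Y :: "'v \<Rightarrow> int \<Rightarrow> 'v \<Rightarrow> 'v" and vac :: 'v
  assumes linear: "linear_vertex_map sV sV Y"
    and injective: "inj Y"
    and truncation: "laurent (op_series Y u v)"
    and jacobi: "jacobi_identity sV Y Y u v w"
    and vacuum: "op_series Y vac v = (\<lambda>i. if i = 0 then v else 0)"
    and creation: "power_series (op_series Y u vac)" "op_series Y u vac 0 = u"

locale module_minor_axioms = V: vertex_algebra sV Y vac + W: vector_space sW
  for sV :: "complex \<Rightarrow> 'v \<Rightarrow> 'v::ab_group_add" and Y and vac
    and sW :: "complex \<Rightarrow> 'w \<Rightarrow> 'w::ab_group_add" +
  fixes YW :: "'v \<Rightarrow> int \<Rightarrow> 'w \<Rightarrow> 'w"
  assumes linear: "linear_vertex_map sV sW YW"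
    and truncation: "laurent (op_series YW u w)"
    and vacuum: "op_series YW vac w = (\<lambda>i. if i = 0 then w else 0)"

end

theory Submission imports Defs begin

text \<open>
  Fix \<open>u, v, w\<close> and let \<open>P\<close>, \<open>O\<close>, \<open>I\<close> be the three terms of the Jacobi identity, so that the identity
  reads \<open>P - O = I\<close>. Write a series in \<open>(x\<^sub>0, x\<^sub>1, x\<^sub>2)\<close> as a function \<open>F l m n\<close>, the coefficient of
  \<open>x\<^sub>0\<^bsup>-l-1\<^esup> x\<^sub>1\<^bsup>-m-1\<^esup> x\<^sub>2\<^bsup>-n-1\<^esup>\<close>. Each of the three terms contains a delta function that identifies
  \<open>x\<^sub>0\<close> with \<open>x\<^sub>1 - x\<^sub>2\<close>, and therefore satisfies \<open>F (l+1) m n = F l (m+1) n - F l m (n+1)\<close>; so does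
  the defect \<open>P - O - I\<close>. Three observations carry the proof.

  \<^item> Truncation makes \<open>P\<close> vanish for large \<open>n\<close>, \<open>O\<close> for large \<open>m\<close> and \<open>I\<close> for large \<open>l\<close>. Weak
    associativity with exponent \<open>m\<close> says exactly that \<open>P = I\<close> in degree \<open>m\<close>, weak skew-associativity
    with exponent \<open>n\<close> that \<open>-O = I\<close> in degree \<open>n\<close>, for all values of the other two indices
    (\<open>weak_associativity_iff\<close>, \<open>weak_skew_associativity_iff\<close>). Hence both follow from the Jacobi
    identity. Conversely, the first forces the defect to vanish for large \<open>m\<close> and the second for
    large \<open>n\<close>.

  \<^item> A solution of the recursion that vanishes for large values of two of its three indices is zero:
    solve the recursion for the entry at the extremal corner and sweep towards smaller indices. So
    weak associativity and weak skew-associativity of the same triple imply the Jacobi identity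
    (\<open>weak_associativities_imp_jacobi\<close>).

  \<^item> Weak skew-associativity of \<open>(u, v, w)\<close> is weak associativity of \<open>(v, u, w)\<close>. Exchanging \<open>u\<close> with
    \<open>v\<close> exchanges \<open>P\<close> with \<open>O\<close> up to the sign \<open>(-1)\<^sup>l\<close>, so it remains to see that \<open>I\<close> is antisymmetric
    in the same sense (\<open>iterate_modes_antisymmetric\<close>). This is skew symmetry
    \<open>Y(u,x)v = e\<^bsup>xD\<^esup> Y(v,-x)u\<close> in \<open>V\<close> combined with \<open>Y\<^sub>W(e\<^bsup>xD\<^esup> a, y) = Y\<^sub>W(a, y+x)\<close> on \<open>W\<close>. The latter
    comes from the Jacobi identity for triples containing the vacuum, which holds because
    the modes of the vacuum commute with all others: the defect then vanishes for large \<open>l\<close>, and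
    either weak hypothesis supplies a second direction (\<open>jacobi_identity_vacuum\<close>).

  The exponents in both weak identities may depend on all of \<open>u, v, w\<close>, because no step
  needs a common exponent for different triples.
\<close>

section \<open>Sums over supports\<close>

lemma Sum_any_reindex:
  assumes "inj f" "\<And>d. g d \<noteq> 0 \<Longrightarrow> d \<in> range f"
  shows "Sum_any g = Sum_any (\<lambda>k. g (f k))"
proof -
  have "{d. g d \<noteq> 0} = f ` {k. g (f k) \<noteq> 0}" using assms(2) by auto
  moreover have "inj_on f {k. g (f k) \<noteq> 0}" using assms(1) by (rule inj_on_subset) simp
  ultimately show ?thesis
    by (simp add: Sum_any.expand_set sum.reindex)
qed

lemma Sum_any_single:
  assumes "\<And>k. k \<noteq> c \<Longrightarrow> f k = 0"
  shows "Sum_any f = f c"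
proof -
  have "Sum_any f = sum f {c}" by (rule Sum_any.expand_superset) (use assms in auto)
  thus ?thesis by simp
qed

lemma scale_Sum_any:
  assumes "vector_space s"
  shows "s c (Sum_any f) = Sum_any (\<lambda>k. s c (f k))"
proof -
  interpret vector_space s by fact
  show ?thesis
  proof (cases "c = 0")
    case False
    hence "{k. s c (f k) \<noteq> 0} = {k. f k \<noteq> 0}" by simp
    thus ?thesis by (simp add: Sum_any.expand_set scale_sum_right)
  qed simp
qed

section \<open>Series annihilated by \<open>x\<^sub>0 - x\<^sub>1 + x\<^sub>2\<close>\<close>

text \<open>
  In generating-function form, \<open>x\<^sub>0 F = (x\<^sub>1 - x\<^sub>2) F\<close> for
  \<open>F = (\<Sum>l m n. F l m n x\<^sub>0\<^bsup>-l-1\<^esup> x\<^sub>1\<^bsup>-m-1\<^esup> x\<^sub>2\<^bsup>-n-1\<^esup>)\<close>.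
\<close>

definition delta_recursion :: "(int \<Rightarrow> int \<Rightarrow> int \<Rightarrow> 'w::ab_group_add) \<Rightarrow> bool" where
  "delta_recursion F \<longleftrightarrow> (\<forall>l m n. F (l + 1) m n = F l (m + 1) n - F l m (n + 1))"

lemma delta_recursion_diff:
  "delta_recursion F \<Longrightarrow> delta_recursion G \<Longrightarrow> delta_recursion (\<lambda>l m n. F l m n - G l m n)"
  by (simp add: delta_recursion_def)

lemma delta_recursion_add:
  "delta_recursion F \<Longrightarrow> delta_recursion G \<Longrightarrow> delta_recursion (\<lambda>l m n. F l m n + G l m n)"
  by (simp add: delta_recursion_def)

lemma delta_recursion_uminus:
  "delta_recursion F \<Longrightarrow> delta_recursion (\<lambda>l m n. - F l m n)"
  by (simp add: delta_recursion_def)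

text \<open>
  Vanishing for large \<open>m\<close> and \<open>n\<close> means that \<open>F\<close> is bounded below in powers of \<open>x\<^sub>1\<close> and of \<open>x\<^sub>2\<close>.
  At \<open>m = M - 1\<close>, \<open>n = N - 1\<close> both terms on the right of the recursion vanish, hence so does the left;
  the induction repeats this for all pairs \<open>(m, n)\<close>, by distance to the region of vanishing.
  The next two lemmas solve the same recursion for each of the other two entries.
\<close>

lemma delta_recursion_vanish_mn:
  assumes rec: "delta_recursion F"
    and M: "\<And>l m n. M \<le> m \<Longrightarrow> F l m n = 0" and N: "\<And>l m n. N \<le> n \<Longrightarrow> F l m n = 0"
  shows "F l m n = 0"
proof (induction "nat (M - m) + nat (N - n)" arbitrary: l m n rule: less_induct)
  case less
  show ?case
  proof (cases "M \<le> m \<or> N \<le> n")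
    case False
    hence "F (l - 1) (m + 1) n = 0" "F (l - 1) m (n + 1) = 0" by (auto intro!: less)
    moreover have "F (l - 1 + 1) m n = F (l - 1) (m + 1) n - F (l - 1) m (n + 1)"
      using rec by (simp only: delta_recursion_def)
    ultimately show ?thesis by simp
  qed (use M N in auto)
qed

lemma delta_recursion_vanish_lm:
  assumes rec: "delta_recursion F"
    and L: "\<And>l m n. L \<le> l \<Longrightarrow> F l m n = 0" and M: "\<And>l m n. M \<le> m \<Longrightarrow> F l m n = 0"
  shows "F l m n = 0"
proof (induction "nat (L - l) + nat (M - m)" arbitrary: l m n rule: less_induct)
  case less
  show ?case
  proof (cases "L \<le> l \<or> M \<le> m")
    case False
    hence "F (l + 1) m (n - 1) = 0" "F l (m + 1) (n - 1) = 0" by (auto intro!: less)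
    moreover have "F (l + 1) m (n - 1) = F l (m + 1) (n - 1) - F l m (n - 1 + 1)"
      using rec by (simp only: delta_recursion_def)
    ultimately show ?thesis by simp
  qed (use L M in auto)
qed

lemma delta_recursion_vanish_ln:
  assumes rec: "delta_recursion F"
    and L: "\<And>l m n. L \<le> l \<Longrightarrow> F l m n = 0" and N: "\<And>l m n. N \<le> n \<Longrightarrow> F l m n = 0"
  shows "F l m n = 0"
proof (induction "nat (L - l) + nat (N - n)" arbitrary: l m n rule: less_induct)
  case less
  show ?case
  proof (cases "L \<le> l \<or> N \<le> n")
    case False
    hence "F (l + 1) (m - 1) n = 0" "F l (m - 1) (n + 1) = 0" by (auto intro!: less)
    moreover have "F (l + 1) (m - 1) n = F l (m - 1 + 1) n - F l (m - 1) (n + 1)"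
      using rec by (simp only: delta_recursion_def)
    ultimately show ?thesis by simp
  qed (use L N in auto)
qed

text \<open>
  Multiplying by \<open>x\<^sub>1 = x\<^sub>0 + x\<^sub>2\<close> expresses the values in degree \<open>m + 1\<close> through those in degree \<open>m\<close>.
  In this way one exponent that works in a weak identity makes all larger ones work.
\<close>

lemma delta_recursion_propagate_m:
  assumes "delta_recursion F" "\<And>l n. F l k n = 0" "k \<le> m"
  shows "F l m n = 0"
  using \<open>k \<le> m\<close>
proof (induction m arbitrary: l n rule: int_ge_induct)
  case (step m)
  have "F (l + 1) m n = F l (m + 1) n - F l m (n + 1)"
    using assms(1) by (simp add: delta_recursion_def)
  thus ?case by (simp add: step)
qed (rule assms(2))

lemma delta_recursion_propagate_n:
  assumes "delta_recursion F" "\<And>l m. F l m k = 0" "k \<le> n"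
  shows "F l m n = 0"
  using \<open>k \<le> n\<close>
proof (induction n arbitrary: l m rule: int_ge_induct)
  case (step n)
  have "F (l + 1) m n = F l (m + 1) n - F l m (n + 1)"
    using assms(1) by (simp add: delta_recursion_def)
  thus ?case by (simp add: step)
qed (rule assms(2))

section \<open>Binomial sums of modes\<close>

text \<open>
  The coefficient of \<open>x\<^bsup>-m-1\<^esup> y\<^bsup>-n-1\<^esup>\<close> in \<open>(x + c y)\<^sup>l (\<Sum>p q. g p q x\<^bsup>-p-1\<^esup> y\<^bsup>-q-1\<^esup>)\<close>. All series of the
  theorem have coefficients of this form with \<open>c = \<plusminus>1\<close>, up to sign and the order of the variables.
\<close>

definition binomial_sum ::
    "(complex \<Rightarrow> 'u \<Rightarrow> 'u) \<Rightarrow> complex \<Rightarrow> int \<Rightarrow> (int \<Rightarrow> int \<Rightarrow> 'u) \<Rightarrow> int \<Rightarrow> int \<Rightarrow> 'u::ab_group_add" where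
  "binomial_sum s c l g m n =
     Sum_any (\<lambda>k. s (c ^ k * (of_int l gchoose k)) (g (l + m - int k) (n + int k)))"

text \<open>
  The two reasons for which the product of \<open>(x + c y)\<^sup>l\<close> with a series is a finite sum in each degree:
  either the power is a polynomial, or the series is bounded below in \<open>y\<close>.
\<close>

definition terminating :: "int \<Rightarrow> (int \<Rightarrow> int \<Rightarrow> 'u::zero) \<Rightarrow> bool" where
  "terminating l g \<longleftrightarrow> 0 \<le> l \<or> (\<exists>Q. \<forall>p q. Q \<le> q \<longrightarrow> g p q = 0)"

lemma of_int_gchoose_eq_0:
  assumes "0 \<le> l" "l < int k"
  shows "(of_int l gchoose k :: complex) = 0"
proof -
  have "(of_int l :: complex) = of_nat (nat l)" using assms(1) by simp
  moreover have "nat l < k" using assms by simp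
  ultimately show ?thesis by (simp add: binomial_gbinomial[symmetric])
qed

lemma binomial_sum_eq_finite_sum:
  assumes "vector_space s"
    and "\<And>k. K \<le> k \<Longrightarrow> (of_int l gchoose k :: complex) = 0 \<or> g (l + m - int k) (n + int k) = 0"
  shows "binomial_sum s c l g m n = (\<Sum>k<K. s (c ^ k * (of_int l gchoose k)) (g (l + m - int k) (n + int k)))"
proof -
  interpret vector_space s by fact
  show ?thesis unfolding binomial_sum_def
  proof (rule Sum_any.expand_superset)
    show "{k. s (c ^ k * (of_int l gchoose k)) (g (l + m - int k) (n + int k)) \<noteq> 0} \<subseteq> {..<K}"
    proof safe
      fix k assume "s (c ^ k * (of_int l gchoose k)) (g (l + m - int k) (n + int k)) \<noteq> 0"
      thus "k < K" using assms(2)[of k] by (cases "K \<le> k") auto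
    qed
  qed simp
qed

lemma binomial_sum_0:
  assumes "vector_space s"
  shows "binomial_sum s c 0 g m n = g m n"
proof -
  interpret vector_space s by fact
  show ?thesis unfolding binomial_sum_def
    by (subst Sum_any_single[where c = 0]) (auto simp: gbinomial_0_left)
qed

text \<open>
  Multiplication by one more factor \<open>x + c y\<close>, that is, Pascal's rule. This is the source of all
  recursions below.
\<close>

lemma binomial_sum_pascal:
  assumes "vector_space s" and "terminating l g"
  shows "binomial_sum s c (l + 1) g m n
    = binomial_sum s c l g (m + 1) n + s c (binomial_sum s c l g m (n + 1))"
proof -
  interpret vector_space s by fact
  \<comment> \<open>One bound \<open>K\<close> for all three sums, so that Pascal's rule can be applied term by term.\<close>
  obtain K where K: "(\<forall>k\<ge>K. (of_int l gchoose k :: complex) = 0 \<and> (of_int (l + 1) gchoose k :: complex) = 0)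
      \<or> (\<forall>p. \<forall>k\<ge>K. g p (n + int k) = 0)"
  proof (cases "0 \<le> l")
    case True
    show thesis
      by (rule that[of "nat l + 2"]) (use True in \<open>auto intro!: disjI1 of_int_gchoose_eq_0 simp del: of_int_add\<close>)
  next
    case False
    then obtain Q where "\<And>p q. Q \<le> q \<Longrightarrow> g p q = 0" using assms(2) by (auto simp: terminating_def)
    thus thesis by (intro that[of "nat (Q - n)"]) auto
  qed
  define T where "T a k = s (c ^ Suc k * a) (g (l + m - int k) (n + 1 + int k))" for a k
  have 1: "binomial_sum s c (l + 1) g m n = s 1 (g (l + 1 + m) n)
      + (\<Sum>k<K. T (of_int (l + 1) gchoose Suc k) k)"
    by (subst binomial_sum_eq_finite_sum[where K = "Suc K"])
      (use assms(1) K in \<open>auto simp: sum.lessThan_Suc_shift T_def algebra_simps simp del: sum.lessThan_Suc\<close>)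
  have 2: "binomial_sum s c l g (m + 1) n = s 1 (g (l + 1 + m) n)
      + (\<Sum>k<K. T (of_int l gchoose Suc k) k)"
    by (subst binomial_sum_eq_finite_sum[where K = "Suc K"])
      (use assms(1) K in \<open>auto simp: sum.lessThan_Suc_shift T_def algebra_simps simp del: sum.lessThan_Suc\<close>)
  have 3: "s c (binomial_sum s c l g m (n + 1)) = (\<Sum>k<K. T (of_int l gchoose k) k)"
  proof (subst binomial_sum_eq_finite_sum[where K = K])
    fix k assume "K \<le> k"
    thus "(of_int l gchoose k :: complex) = 0 \<or> g (l + m - int k) (n + 1 + int k) = 0"
      using K by (auto simp: add.assoc simp flip: of_nat_Suc)
  qed (use assms(1) in \<open>auto simp: scale_sum_right T_def algebra_simps\<close>)
  have "T (of_int (l + 1) gchoose Suc k) k = T (of_int l gchoose Suc k) k + T (of_int l gchoose k) k" for k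
    using gbinomial_Suc_Suc[of "of_int l :: complex" k]
    by (simp add: T_def distrib_left add.commute flip: scale_left_distrib)
  thus ?thesis unfolding 1 2 3 by (simp add: sum.distrib)
qed

section \<open>Coefficients of substitutions and products\<close>

lemma binomial_expansion_line:
  "binomial_expansion a b n (n - int k, int k) = (of_int n gchoose k) * a powi (n - int k) * b ^ k"
  by (simp add: binomial_expansion_def)

lemma binomial_expansion_support:
  "binomial_expansion a b n (i, j) \<noteq> 0 \<Longrightarrow> \<exists>k. i = n - int k \<and> j = int k"
  by (auto simp: binomial_expansion_def intro!: exI[of _ "nat j"] split: if_splits)

text \<open>
  Only \<open>(a x + b y)\<^sup>p y\<^sup>q\<close> with \<open>p = k - l - 1\<close>, \<open>q = -n - 1 - k\<close> and \<open>k \<ge> 0\<close> contributes, with the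
  binomial coefficient \<open>k - l - 1\<close> over \<open>k\<close>. Negating the upper index turns it into \<open>(-1)\<^sup>k\<close> times
  \<open>l\<close> over \<open>k\<close>, which is why \<open>b\<close> on the left becomes \<open>-b\<close> on the right: the substitution
  \<open>x\<^sub>1 = x\<^sub>0 + x\<^sub>2\<close> is read off as a power of \<open>x\<^sub>0 = x\<^sub>1 - x\<^sub>2\<close>.
\<close>

lemma subst_binomial_coeff:
  assumes "vector_space s"
  shows "subst_binomial s a b F (- l - 1, - n - 1)
    = s (a powi (- l - 1)) (binomial_sum s (- b) l (\<lambda>p q. F (- p - 1, - q - 1)) 0 n)"
proof -
  interpret vector_space s by fact
  have coeff: "binomial_expansion a b (int k - l - 1) (- l - 1, int k)
      = a powi (- l - 1) * ((- b) ^ k * (of_int l gchoose k))" for k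
    using gbinomial_negated_upper[of "of_int l :: complex" k]
    by (simp add: binomial_expansion_def flip: power_mult_distrib)
  show ?thesis
    unfolding subst_binomial_def binomial_sum_def prod.case scale_Sum_any[OF assms]
  proof (subst Sum_any_reindex[where f = "\<lambda>k. (int k - l - 1, - n - 1 - int k)"], goal_cases)
    case (2 d)
    then obtain p q where d: "d = (p, q)" and "binomial_expansion a b p (- l - 1, - n - 1 - q) \<noteq> 0"
      by (cases d) auto
    then obtain k where "- l - 1 = p - int k" "- n - 1 - q = int k"
      using binomial_expansion_support by blast
    hence "d = (int k - l - 1, - n - 1 - int k)" using d by simp
    thus ?case by blast
  next
    case 3
    have "- n - 1 - (- n - 1 - int k) = int k" "- (l + 0 - int k) - 1 = int k - l - 1"
      "- (n + int k) - 1 = - n - 1 - int k" for k by simp_all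
    thus ?case by (simp only: prod.case coeff scale_scale)
  qed (auto simp: inj_on_def)
qed

lemma series_mult_binomial_coeff:
  assumes "vector_space s"
  shows "series_mult s (\<lambda>(i, j). binomial_expansion 1 b (int N) (i, j)) G (- l - 1, - n - 1)
    = binomial_sum s b (int N) (\<lambda>p q. G (- p - 1, - q - 1)) l n"
proof -
  interpret vector_space s by fact
  show ?thesis unfolding series_mult_def binomial_sum_def
  proof (subst Sum_any_reindex[where f = "\<lambda>k. (int N - int k, int k)"], goal_cases)
    case (2 d)
    thus ?case by (cases d) (auto dest!: binomial_expansion_support)
  next
    case 3
    show ?case
      by (rule arg_cong[of _ _ Sum_any], rule ext)
        (simp only: prod.case binomial_expansion_line diff_Pair, simp add: algebra_simps)
  qed (auto simp: inj_on_def)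
qed

lemma series_mult_swap:
  "series_mult s (\<lambda>(i, j). F (j, i)) G (a, b) = series_mult s F (\<lambda>(i, j). G (j, i)) (b, a)"
  unfolding series_mult_def
  by (subst Sum_any_reindex[where f = prod.swap]) (auto intro!: arg_cong[of _ _ Sum_any])

text \<open>
  The prefactors \<open>(x\<^sub>0 + x\<^sub>2)\<^sup>N\<close> and \<open>(x\<^sub>1 - x\<^sub>0)\<^sup>N\<close> of the weak identities act on a solution of the
  recursion as \<open>x\<^sub>1\<^sup>N\<close> and \<open>x\<^sub>2\<^sup>N\<close>: they shift \<open>m\<close> and \<open>n\<close> from \<open>0\<close> to \<open>N\<close>.
\<close>

lemma delta_recursion_binomial_sum_m:
  assumes "vector_space s" and rec: "delta_recursion F"
  shows "binomial_sum s 1 (int N) (\<lambda>p q. F p 0 q) l n = F l (int N) n"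
proof (induction N arbitrary: l n)
  case 0
  show ?case by (simp add: binomial_sum_0[OF assms(1)])
next
  case (Suc N)
  interpret vector_space s by fact
  have "binomial_sum s c (int (Suc N)) g a b
      = binomial_sum s c (int N) g (a + 1) b + s c (binomial_sum s c (int N) g a (b + 1))" for c g a b
    using binomial_sum_pascal[OF assms(1), of "int N"] by (simp add: terminating_def add.commute)
  moreover have "F (x + 1) y z = F x (y + 1) z - F x y (z + 1)" for x y z
    using rec by (simp add: delta_recursion_def)
  ultimately show ?case by (simp add: Suc add.commute[of 1 "int N"])
qed

lemma delta_recursion_binomial_sum_n:
  assumes "vector_space s" and rec: "delta_recursion F"
  shows "binomial_sum s (-1) (int N) (\<lambda>p q. F q p 0) m l = F l m (int N)"
proof (induction N arbitrary: l m)
  case 0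
  show ?case by (simp add: binomial_sum_0[OF assms(1)])
next
  case (Suc N)
  interpret vector_space s by fact
  have "binomial_sum s c (int (Suc N)) g a b
      = binomial_sum s c (int N) g (a + 1) b + s c (binomial_sum s c (int N) g a (b + 1))" for c g a b
    using binomial_sum_pascal[OF assms(1), of "int N"] by (simp add: terminating_def add.commute)
  moreover have "F (x + 1) y z = F x (y + 1) z - F x y (z + 1)" for x y z
    using rec by (simp add: delta_recursion_def)
  ultimately show ?case by (simp add: Suc add.commute[of 1 "int N"])
qed

lemma all_exponent_pairs_iff: "(\<forall>e. P e) \<longleftrightarrow> (\<forall>l n. P (- l - 1, - n - 1))"
  for P :: "int \<times> int \<Rightarrow> bool"
proof safe
  fix a b assume "\<forall>l n. P (- l - 1, - n - 1)"
  from this[rule_format, of "- a - 1" "- b - 1"] show "P (a, b)" by simp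
qed auto

section \<open>The three terms of the Jacobi identity\<close>

context module_minor_axioms
begin

text \<open>
  The coefficients of \<open>x\<^sub>0\<^bsup>-l-1\<^esup> x\<^sub>1\<^bsup>-m-1\<^esup> x\<^sub>2\<^bsup>-n-1\<^esup>\<close> in the three terms of the Jacobi identity. In
  \<open>opposite_modes\<close>, the sign arises from rewriting \<open>(-x\<^sub>2 + x\<^sub>1)\<^sup>l\<close> as \<open>(-1)\<^sup>l (x\<^sub>2 - x\<^sub>1)\<^sup>l\<close>. In
  \<open>iterate_modes\<close>, the power \<open>(x\<^sub>2 + x\<^sub>0)\<^sup>m\<close> is expanded in nonnegative powers of \<open>x\<^sub>0\<close>, so the index of
  \<open>Y\<close> is the one that increases.
\<close>

definition product_modes :: "'v \<Rightarrow> 'v \<Rightarrow> 'w \<Rightarrow> int \<Rightarrow> int \<Rightarrow> int \<Rightarrow> 'w" where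
  "product_modes u v w l m n = binomial_sum sW (-1) l (\<lambda>p q. YW u p (YW v q w)) m n"

definition opposite_modes :: "'v \<Rightarrow> 'v \<Rightarrow> 'w \<Rightarrow> int \<Rightarrow> int \<Rightarrow> int \<Rightarrow> 'w" where
  "opposite_modes u v w l m n = sW ((-1) powi l) (product_modes v u w l n m)"

definition iterate_modes :: "'v \<Rightarrow> 'v \<Rightarrow> 'w \<Rightarrow> int \<Rightarrow> int \<Rightarrow> int \<Rightarrow> 'w" where
  "iterate_modes u v w l m n = binomial_sum sW 1 m (\<lambda>p q. YW (Y u q v) p w) n l"

lemma YW_zero [simp]: "YW u n 0 = 0" "YW 0 n w = 0"
proof -
  have "Vector_Spaces.linear sW sW (YW u n)" "Vector_Spaces.linear sV sW (\<lambda>v. YW v n w)"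
    using linear by (auto simp: linear_vertex_map_def)
  thus "YW u n 0 = 0" "YW 0 n w = 0"
    by (auto dest: Vector_Spaces.linear.axioms(3) module_hom.zero simp: module_hom_iff_linear[symmetric])
qed

lemma modes_eventually_zero: "\<exists>N. \<forall>n\<ge>N. YW u n w = 0"
proof -
  obtain N where N: "\<And>n. n < N \<Longrightarrow> op_series YW u w n = 0"
    using truncation unfolding laurent_def by blast
  have "YW u n w = 0" if "- N \<le> n" for n
    using that N[of "- n - 1"] by (simp add: op_series_def)
  thus ?thesis by blast
qed

lemma vacuum_modes: "YW vac q w = (if q = -1 then w else 0)"
  using fun_cong[OF vacuum, of w "- q - 1"] by (auto simp: op_series_def)

text \<open>
  Results about modules thus apply to \<open>V\<close> itself: its truncation property is used through
  \<open>Y_eventually_zero\<close>, and its own Jacobi identity gives skew symmetry.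
\<close>

lemma self_module: "module_minor_axioms sV Y vac sV Y"
  by unfold_locales (auto intro: V.linear V.truncation V.vacuum)

lemma Y_eventually_zero: "\<exists>N. \<forall>n\<ge>N. Y u n v = 0"
  by (rule module_minor_axioms.modes_eventually_zero[OF self_module])

lemma product_terminates: "terminating l (\<lambda>p q. YW u p (YW v q w))"
  unfolding terminating_def using modes_eventually_zero[of v w] by fastforce

lemma iterate_terminates: "terminating l (\<lambda>p q. YW (Y u q v) p w)"
  unfolding terminating_def using Y_eventually_zero[of u v] by fastforce

lemma product_modes_0: "product_modes u v w 0 m n = YW u m (YW v n w)"
  by (simp add: product_modes_def binomial_sum_0[OF W.vector_space_axioms])

lemma iterate_modes_0: "iterate_modes u v w l 0 n = YW (Y u l v) n w"
  by (simp add: iterate_modes_def binomial_sum_0[OF W.vector_space_axioms])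

lemma delta_recursion_product_modes: "delta_recursion (product_modes u v w)"
  by (simp add: delta_recursion_def product_modes_def
      binomial_sum_pascal[OF W.vector_space_axioms product_terminates])

lemma delta_recursion_opposite_modes: "delta_recursion (opposite_modes u v w)"
  using delta_recursion_product_modes[of v u w]
  by (simp add: delta_recursion_def opposite_modes_def power_int_add_1 W.scale_right_diff_distrib)

lemma delta_recursion_iterate_modes: "delta_recursion (iterate_modes u v w)"
  by (simp add: delta_recursion_def iterate_modes_def
      binomial_sum_pascal[OF W.vector_space_axioms iterate_terminates])

text \<open>
  Each of the three terms vanishes when one of its indices is large, because the mode that this
  index bounds from below kills the vector it is applied to. The index bounds are taken
  nonnegative so that they can serve as exponents of the weak identities.
\<close>

lemma product_modes_eventually_zero: "\<exists>N\<ge>0. \<forall>n\<ge>N. \<forall>l m. product_modes u v w l m n = 0"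
proof -
  obtain N where "\<And>n. n \<ge> N \<Longrightarrow> YW v n w = 0" using modes_eventually_zero by blast
  hence "\<forall>n\<ge>max 0 N. \<forall>l m. product_modes u v w l m n = 0"
    by (simp add: product_modes_def binomial_sum_def)
  thus ?thesis by (rule_tac exI[of _ "max 0 N"]) simp
qed

lemma opposite_modes_eventually_zero: "\<exists>M\<ge>0. \<forall>m\<ge>M. \<forall>l n. opposite_modes u v w l m n = 0"
  using product_modes_eventually_zero[of v u w] by (auto simp: opposite_modes_def)

lemma iterate_modes_eventually_zero: "\<exists>L\<ge>0. \<forall>l\<ge>L. \<forall>m n. iterate_modes u v w l m n = 0"
proof -
  obtain N where "\<And>n. n \<ge> N \<Longrightarrow> Y u n v = 0" using Y_eventually_zero by blast
  hence "\<forall>l\<ge>max 0 N. \<forall>m n. iterate_modes u v w l m n = 0"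
    by (simp add: iterate_modes_def binomial_sum_def)
  thus ?thesis by (rule_tac exI[of _ "max 0 N"]) simp
qed

section \<open>The identities in terms of coefficients\<close>

text \<open>
  In each of the next three lemmas the delta function has one free summation index \<open>k\<close> once the
  exponent of the variable absent from the vertex operators is fixed.
\<close>

lemma jacobi_first_term:
  "series_mult sW (\<lambda>(i0, i1, i2). delta_expansion 1 (-1) (i0, i1, i2))
     (\<lambda>(i0, i1, i2). if i0 = 0 then product_series YW u v w (i1, i2) else 0) (- l - 1, - m - 1, - n - 1)
   = product_modes u v w l m n"
  unfolding series_mult_def product_modes_def binomial_sum_def
proof (subst Sum_any_reindex[where f = "\<lambda>k. (- l - 1, l - int k, int k)"], goal_cases)
  case (2 d)
  thus ?case by (cases d) (auto simp: delta_expansion_def split: if_splits dest!: binomial_expansion_support)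
next
  case 3
  show ?case
    by (rule arg_cong[of _ _ Sum_any], rule ext)
      (simp add: delta_expansion_def binomial_expansion_line product_series_def op_series_def algebra_simps)
qed (auto simp: inj_on_def)

lemma jacobi_second_term:
  "series_mult sW (\<lambda>(i0, i1, i2). delta_expansion (-1) 1 (i0, i2, i1))
     (\<lambda>(i0, i1, i2). if i0 = 0 then product_series YW v u w (i2, i1) else 0) (- l - 1, - m - 1, - n - 1)
   = opposite_modes u v w l m n"
  unfolding series_mult_def opposite_modes_def product_modes_def binomial_sum_def
    scale_Sum_any[OF W.vector_space_axioms]
proof (subst Sum_any_reindex[where f = "\<lambda>k. (- l - 1, int k, l - int k)"], goal_cases)
  case (2 d)
  thus ?case by (cases d) (auto simp: delta_expansion_def split: if_splits dest!: binomial_expansion_support)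
next
  case 3
  have "(-1) powi (l - int k) = ((-1) powi l * (-1) ^ k :: complex)" for k
    by (cases "even k") (simp_all add: power_int_diff)
  thus ?case
    by (intro arg_cong[of _ _ Sum_any] ext)
      (simp add: delta_expansion_def binomial_expansion_line product_series_def op_series_def algebra_simps)
qed (auto simp: inj_on_def)

lemma jacobi_third_term:
  "series_mult sW (\<lambda>(i0, i1, i2). delta_expansion 1 1 (i1, i2, i0))
     (\<lambda>(i0, i1, i2). if i1 = 0 then iterate_series Y YW u v w (i0, i2) else 0) (- l - 1, - m - 1, - n - 1)
   = iterate_modes u v w l m n"
  unfolding series_mult_def iterate_modes_def binomial_sum_def
proof (subst Sum_any_reindex[where f = "\<lambda>k. (int k, - m - 1, m - int k)"], goal_cases)
  case (2 d)
  thus ?case by (cases d) (auto simp: delta_expansion_def split: if_splits dest!: binomial_expansion_support)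
next
  case 3
  show ?case
    by (rule arg_cong[of _ _ Sum_any], rule ext)
      (simp add: delta_expansion_def binomial_expansion_line iterate_series_def op_series_def algebra_simps)
qed (auto simp: inj_on_def)

lemma jacobi_identity_iff:
  "jacobi_identity sW Y YW u v w \<longleftrightarrow>
    (\<forall>l m n. product_modes u v w l m n - opposite_modes u v w l m n = iterate_modes u v w l m n)"
proof -
  have *: "(\<forall>e. P e) \<longleftrightarrow> (\<forall>l m n. P (- l - 1, - m - 1, - n - 1))" for P :: "int \<times> int \<times> int \<Rightarrow> bool"
  proof safe
    fix a b c assume "\<forall>l m n. P (- l - 1, - m - 1, - n - 1)"
    from this[rule_format, of "- a - 1" "- b - 1" "- c - 1"] show "P (a, b, c)" by simp
  qed auto
  show ?thesis unfolding jacobi_identity_def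
    by (subst *) (simp only: jacobi_first_term jacobi_second_term jacobi_third_term)
qed

definition jacobi_defect :: "'v \<Rightarrow> 'v \<Rightarrow> 'w \<Rightarrow> int \<Rightarrow> int \<Rightarrow> int \<Rightarrow> 'w" where
  "jacobi_defect u v w l m n = product_modes u v w l m n - opposite_modes u v w l m n - iterate_modes u v w l m n"

lemma delta_recursion_jacobi_defect: "delta_recursion (jacobi_defect u v w)"
  unfolding jacobi_defect_def
  by (intro delta_recursion_diff delta_recursion_product_modes delta_recursion_opposite_modes
      delta_recursion_iterate_modes)

lemma jacobi_identity_iff_defect:
  "jacobi_identity sW Y YW u v w \<longleftrightarrow> (\<forall>l m n. jacobi_defect u v w l m n = 0)"
  by (simp add: jacobi_identity_iff jacobi_defect_def)

text \<open>
  Exchanging \<open>(u, x\<^sub>1)\<close> with \<open>(v, x\<^sub>2)\<close> and \<open>x\<^sub>0\<close> with \<open>-x\<^sub>0\<close> interchanges the two products on the left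
  of the Jacobi identity; comparing the identity for \<open>(u, v)\<close> with the one for \<open>(v, u)\<close> leaves a
  relation between iterates only.
\<close>

lemma jacobi_identity_imp_iterate_antisymmetric:
  assumes "jacobi_identity sW Y YW u v w" and "jacobi_identity sW Y YW v u w"
  shows "iterate_modes u v w l m n = - sW ((-1) powi l) (iterate_modes v u w l n m)"
proof -
  have sq: "((-1) powi l :: complex) * (-1) powi l = 1"
    by (simp flip: power_int_mult_distrib)
  have "iterate_modes u v w l m n = product_modes u v w l m n - sW ((-1) powi l) (product_modes v u w l n m)"
    "iterate_modes v u w l n m = product_modes v u w l n m - sW ((-1) powi l) (product_modes u v w l m n)"
    using assms unfolding jacobi_identity_iff opposite_modes_def by simp_all
  thus ?thesis using sq by (simp add: W.scale_right_diff_distrib)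
qed

text \<open>
  For exponent \<open>0\<close> the two series are the coefficients of the product and the iterate in degree
  \<open>m = 0\<close>; the prefactor shifts this degree to \<open>N\<close>.
\<close>

lemma weak_associativity_iff:
  "weak_associativity sW Y YW u v w N \<longleftrightarrow>
    (\<forall>l n. product_modes u v w l (int N) n = iterate_modes u v w l (int N) n)"
proof -
  let ?F = "\<lambda>l m n. product_modes u v w l m n - iterate_modes u v w l m n"
  have "subst_binomial sW 1 1 (product_series YW u v w) (- l - 1, - n - 1) = product_modes u v w l 0 n" for l n
    by (simp add: subst_binomial_coeff[OF W.vector_space_axioms] product_series_def op_series_def product_modes_def)
  moreover have "iterate_series Y YW u v w (- l - 1, - n - 1) = iterate_modes u v w l 0 n" for l n
    by (simp add: iterate_series_def op_series_def iterate_modes_0)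
  ultimately have "series_mult sW (\<lambda>(i0, i2). binomial_expansion 1 1 (int N) (i0, i2))
      (\<lambda>(i0, i2). subst_binomial sW 1 1 (product_series YW u v w) (i0, i2)
                  - iterate_series Y YW u v w (i0, i2)) (- l - 1, - n - 1) = ?F l (int N) n" for l n
    unfolding series_mult_binomial_coeff[OF W.vector_space_axioms]
    using delta_recursion_binomial_sum_m[OF W.vector_space_axioms
        delta_recursion_diff[OF delta_recursion_product_modes delta_recursion_iterate_modes], of N u v w u v w l n]
    by simp
  thus ?thesis unfolding weak_associativity_def by (subst all_exponent_pairs_iff) simp
qed

lemma weak_skew_associativity_iff:
  "weak_skew_associativity sW Y YW u v w N \<longleftrightarrow>
    (\<forall>l m. - opposite_modes u v w l m (int N) = iterate_modes u v w l m (int N))"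
proof -
  let ?F = "\<lambda>l m n. opposite_modes u v w l m n + iterate_modes u v w l m n"
  let ?G = "\<lambda>(i0, i1). subst_binomial sW (-1) 1 (product_series YW v u w) (i0, i1)
      - subst_binomial sW 1 (-1) (\<lambda>(i, j). iterate_series Y YW u v w (j, i)) (i1, i0)"
  \<comment> \<open>The substitution \<open>-x\<^sub>0 + x\<^sub>1\<close> contributes the sign \<open>(-1)\<^bsup>-l-1\<^esup>\<close>, which is opposite to the sign in
    \<open>opposite_modes\<close>.\<close>
  have "(-1) powi (- l - 1) = - ((-1) powi l :: complex)" for l
    by (simp add: power_int_diff power_int_minus_one_minus)
  hence "subst_binomial sW (-1) 1 (product_series YW v u w) (- l - 1, - m - 1) = - opposite_modes u v w l m 0" for l m
    by (simp add: subst_binomial_coeff[OF W.vector_space_axioms] product_series_def op_series_def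
        product_modes_def opposite_modes_def)
  moreover have "subst_binomial sW 1 (-1) (\<lambda>(i, j). iterate_series Y YW u v w (j, i)) (- m - 1, - l - 1)
      = iterate_modes u v w l m 0" for l m
    by (simp add: subst_binomial_coeff[OF W.vector_space_axioms] iterate_series_def op_series_def iterate_modes_def)
  ultimately have G: "?G (- l - 1, - m - 1) = - ?F l m 0" for l m
    by simp
  have "delta_recursion (\<lambda>l m n. - ?F l m n)"
    by (intro delta_recursion_uminus delta_recursion_add
        delta_recursion_opposite_modes delta_recursion_iterate_modes)
  note sum_F = delta_recursion_binomial_sum_n[OF W.vector_space_axioms this]
  have "series_mult sW (\<lambda>(i0, i1). binomial_expansion 1 (-1) (int N) (i1, i0)) ?G (- l - 1, - m - 1)
      = - ?F l m (int N)" for l m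
  proof -
    have "series_mult sW (\<lambda>(i0, i1). binomial_expansion 1 (-1) (int N) (i1, i0)) ?G (- l - 1, - m - 1)
        = series_mult sW (\<lambda>(i, j). binomial_expansion 1 (-1) (int N) (i, j)) (\<lambda>(i, j). ?G (j, i)) (- m - 1, - l - 1)"
      using series_mult_swap[of sW "\<lambda>(i, j). binomial_expansion 1 (-1) (int N) (i, j)" ?G] by simp
    also have "\<dots> = binomial_sum sW (-1) (int N) (\<lambda>p q. ?G (- q - 1, - p - 1)) m l"
      by (simp only: series_mult_binomial_coeff[OF W.vector_space_axioms] prod.case)
    also have "\<dots> = - ?F l m (int N)"
      by (simp only: G sum_F)
    finally show ?thesis .
  qed
  hence "weak_skew_associativity sW Y YW u v w N \<longleftrightarrow> (\<forall>l m. - ?F l m (int N) = 0)"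
    unfolding weak_skew_associativity_def by (subst all_exponent_pairs_iff) (simp only:)
  also have "\<dots> \<longleftrightarrow> (\<forall>l m. - opposite_modes u v w l m (int N) = iterate_modes u v w l m (int N))"
    by (auto simp: add_eq_0_iff)
  finally show ?thesis .
qed

section \<open>Vanishing of the defect in one direction\<close>

text \<open>
  The weak identity removes two of the three terms of the defect in all large degrees, and
  truncation removes the remaining one.
\<close>

lemma jacobi_defect_weak_associativity:
  assumes "weak_associativity sW Y YW u v w N"
  shows "\<exists>M. \<forall>m\<ge>M. \<forall>l n. jacobi_defect u v w l m n = 0"
proof -
  obtain M where M: "\<forall>m\<ge>M. \<forall>l n. opposite_modes u v w l m n = 0"
    using opposite_modes_eventually_zero by blast
  have "product_modes u v w l m n - iterate_modes u v w l m n = 0" if "int N \<le> m" for l m n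
    by (rule delta_recursion_propagate_m[OF delta_recursion_diff[OF
          delta_recursion_product_modes delta_recursion_iterate_modes] _ that])
      (use assms in \<open>simp add: weak_associativity_iff\<close>)
  hence "\<forall>m\<ge>max M (int N). \<forall>l n. jacobi_defect u v w l m n = 0"
    using M by (simp add: jacobi_defect_def)
  thus ?thesis by blast
qed

lemma jacobi_defect_weak_skew_associativity:
  assumes "weak_skew_associativity sW Y YW u v w N"
  shows "\<exists>M. \<forall>n\<ge>M. \<forall>l m. jacobi_defect u v w l m n = 0"
proof -
  obtain M where M: "\<forall>n\<ge>M. \<forall>l m. product_modes u v w l m n = 0"
    using product_modes_eventually_zero by blast
  have "- opposite_modes u v w l m n - iterate_modes u v w l m n = 0" if "int N \<le> n" for l m n
    by (rule delta_recursion_propagate_n[OF delta_recursion_diff[OF delta_recursion_uminus[OF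
          delta_recursion_opposite_modes] delta_recursion_iterate_modes] _ that])
      (use assms in \<open>simp add: weak_skew_associativity_iff\<close>)
  hence "\<forall>n\<ge>max M (int N). \<forall>l m. jacobi_defect u v w l m n = 0"
    using M by (simp add: jacobi_defect_def)
  thus ?thesis by blast
qed

section \<open>The vacuum and skew symmetry\<close>

text \<open>
  For \<open>l = 0\<close> the claim is that \<open>a\<^sub>m b\<^sub>n = b\<^sub>n a\<^sub>m\<close>, which is clear as each mode of the vacuum is \<open>0\<close> or
  the identity. The recursion carries it to all \<open>l \<ge> 0\<close>.
\<close>

lemma vacuum_commutes:
  assumes "a = vac \<or> b = vac" and "0 \<le> l"
  shows "product_modes a b w l m n = opposite_modes a b w l m n"
  using \<open>0 \<le> l\<close>
proof (induction l arbitrary: m n rule: int_ge_induct)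
  case base
  show ?case using assms(1) by (auto simp: opposite_modes_def product_modes_0 vacuum_modes)
next
  case (step l)
  thus ?case
    using delta_recursion_product_modes[of a b w] delta_recursion_opposite_modes[of a b w]
    by (simp add: delta_recursion_def)
qed

lemma jacobi_defect_vacuum:
  assumes "a = vac \<or> b = vac"
  shows "\<exists>L. \<forall>l\<ge>L. \<forall>m n. jacobi_defect a b w l m n = 0"
proof -
  obtain L where "0 \<le> L" "\<forall>l\<ge>L. \<forall>m n. iterate_modes a b w l m n = 0"
    using iterate_modes_eventually_zero by blast
  hence "\<forall>l\<ge>L. \<forall>m n. jacobi_defect a b w l m n = 0"
    by (simp add: jacobi_defect_def vacuum_commutes[OF assms])
  thus ?thesis by blast
qed

text \<open>
  Commutativity with the vacuum makes the defect vanish for large \<open>l\<close>, so a single weak identity is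
  enough.
\<close>

lemma jacobi_identity_vacuum:
  assumes vac: "a = vac \<or> b = vac"
    and "(\<exists>N. weak_associativity sW Y YW a b w N) \<or> (\<exists>N. weak_skew_associativity sW Y YW a b w N)"
  shows "jacobi_identity sW Y YW a b w"
proof -
  obtain L where L: "\<And>l m n. L \<le> l \<Longrightarrow> jacobi_defect a b w l m n = 0"
    using jacobi_defect_vacuum[OF vac] by blast
  from assms(2) show ?thesis
  proof (elim disjE exE)
    fix N assume "weak_associativity sW Y YW a b w N"
    then obtain M where "\<And>l m n. M \<le> m \<Longrightarrow> jacobi_defect a b w l m n = 0"
      using jacobi_defect_weak_associativity by blast
    thus ?thesis unfolding jacobi_identity_iff_defect
      using delta_recursion_vanish_lm[OF delta_recursion_jacobi_defect L] by blast
  next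
    fix N assume "weak_skew_associativity sW Y YW a b w N"
    then obtain M where "\<And>l m n. M \<le> n \<Longrightarrow> jacobi_defect a b w l m n = 0"
      using jacobi_defect_weak_skew_associativity by blast
    thus ?thesis unfolding jacobi_identity_iff_defect
      using delta_recursion_vanish_ln[OF delta_recursion_jacobi_defect L] by blast
  qed
qed

text \<open>
  The vector \<open>a\<^bsub>-1-i\<^esub> \<one>\<close> is \<open>D\<^sup>i a / i!\<close> for the translation operator \<open>D\<close>, so this is the derivative
  property \<open>Y\<^sub>W(D\<^sup>i a / i!, x) = (1 / i!) (d/dx)\<^sup>i Y\<^sub>W(a, x)\<close>. Antisymmetry of the iterate turns
  \<open>(a\<^sub>l \<one>)\<^sub>n\<close> into a sum over the vectors \<open>\<one>\<^bsub>l+k\<^esub> a\<close>, of which only the one with \<open>l + k = -1\<close> is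
  nonzero.
\<close>

lemma vacuum_derivative:
  assumes "jacobi_identity sW Y YW a vac w" "jacobi_identity sW Y YW vac a w"
  shows "YW (Y a (- 1 - int i) vac) n w = sW ((-1) ^ i * (of_int n gchoose i)) (YW a (n - int i) w)"
proof -
  interpret Self: module_minor_axioms sV Y vac sV Y by (rule self_module)
  have "iterate_modes vac a w (- 1 - int i) n 0 = sW (of_int n gchoose i) (YW a (n - int i) w)"
    unfolding iterate_modes_def binomial_sum_def
    by (subst Sum_any_single[where c = i]) (auto simp: Self.vacuum_modes)
  moreover have "(-1) powi (- 1 - int i) = - ((-1) ^ i :: complex)"
    by (cases "even i") (simp_all add: power_int_diff)
  ultimately show ?thesis
    using jacobi_identity_imp_iterate_antisymmetric[OF assms, of "- 1 - int i" 0 n]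
    by (simp add: iterate_modes_0)
qed

text \<open>
  This is \<open>Y(u,x)v = e\<^bsup>xD\<^esup> Y(v,-x)u\<close>, with \<open>D\<^sup>k a / k!\<close> written as \<open>a\<^bsub>-1-k\<^esub> \<one>\<close> and \<open>(-1)\<^sup>k\<close> as \<open>-1\<close> over
  \<open>k\<close>. It is the antisymmetry of the iterate acting on the vacuum vector, read at \<open>m = 0\<close>, \<open>n = -1\<close>,
  where \<open>(u\<^sub>l v)\<^bsub>-1\<^esub> \<one> = u\<^sub>l v\<close> by the creation property.
\<close>

lemma skew_symmetry:
  assumes "\<And>k. K \<le> k \<Longrightarrow> Y v (l + int k) u = 0"
  shows "Y u l v = - sV ((-1) powi l) (\<Sum>k<K. sV (of_int (-1) gchoose k) (Y (Y v (l + int k) u) (- 1 - int k) vac))"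
proof -
  interpret Self: module_minor_axioms sV Y vac sV Y by (rule self_module)
  have "Y x (- 1) vac = x" for x
    using V.creation(2)[of x] by (simp add: op_series_def)
  thus ?thesis
    using Self.jacobi_identity_imp_iterate_antisymmetric[OF V.jacobi V.jacobi, of u v vac l 0 "- 1"] assms
    by (simp add: Self.iterate_modes_0)
      (simp add: Self.iterate_modes_def binomial_sum_eq_finite_sum[OF V.vector_space_axioms, where K = K])
qed

text \<open>
  Here only triples containing the vacuum are assumed to satisfy the Jacobi identity. For \<open>m = 0\<close>,
  skew symmetry in \<open>V\<close> expands \<open>u\<^sub>l v\<close> in the vectors \<open>(v\<^bsub>l+k\<^esub> u)\<^bsub>-1-k\<^esub> \<one>\<close>, on which the derivative
  property evaluates \<open>Y\<^sub>W\<close>. Both sides satisfy the same recursion, which raises \<open>m\<close>.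
\<close>

lemma iterate_modes_antisymmetric:
  assumes "\<And>a. jacobi_identity sW Y YW a vac w" "\<And>a. jacobi_identity sW Y YW vac a w"
  shows "iterate_modes u v w l (int m) n = - sW ((-1) powi l) (iterate_modes v u w l n (int m))"
proof (induction m arbitrary: l n)
  case 0
  obtain N where N: "\<And>q. N \<le> q \<Longrightarrow> Y v q u = 0"
    using Y_eventually_zero by blast
  define K where "K = nat (N - l)"
  have K: "Y v (l + int k) u = 0" if "K \<le> k" for k
    using that by (intro N) (simp add: K_def)
  have "Vector_Spaces.linear sV sW (\<lambda>x. YW x n w)"
    using linear by (simp add: linear_vertex_map_def)
  then interpret lin: Vector_Spaces.linear sV sW "\<lambda>x. YW x n w" .
  \<comment> \<open>The signs \<open>(-1)\<^sup>k\<close> of skew symmetry and of the derivative property cancel.\<close>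
  have neg1: "(of_int (-1) gchoose k) * ((-1) ^ k * c) = (c :: complex)" for k c
    using gbinomial_negated_upper[of "-1 :: complex" k]
    by (cases "even k") (simp_all flip: binomial_gbinomial)
  have "YW (Y u l v) n w = - sW ((-1) powi l) (\<Sum>k<K. sW (of_int n gchoose k) (YW (Y v (l + int k) u) (n - int k) w))"
    by (subst skew_symmetry[where K = K])
      (simp_all add: K lin.neg lin.scale lin.sum vacuum_derivative[OF assms] neg1 del: of_int_minus of_int_numeral of_int_neg_numeral of_int_1)
  also have "(\<Sum>k<K. sW (of_int n gchoose k) (YW (Y v (l + int k) u) (n - int k) w)) = iterate_modes v u w l n 0"
    unfolding iterate_modes_def
    by (subst binomial_sum_eq_finite_sum[OF W.vector_space_axioms, where K = K]) (simp_all add: K)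
  finally show ?case by (simp add: iterate_modes_0)
next
  case (Suc m)
  have rec: "iterate_modes x y w (l + 1) m n = iterate_modes x y w l (m + 1) n - iterate_modes x y w l m (n + 1)" for x y l m n
    using delta_recursion_iterate_modes by (simp add: delta_recursion_def)
  have "iterate_modes u v w l (int (Suc m)) n = iterate_modes u v w (l + 1) (int m) n + iterate_modes u v w l (int m) (n + 1)"
    using rec[of u v l "int m" n] by (simp add: algebra_simps)
  also have "\<dots> = sW ((-1) powi l) (iterate_modes v u w (l + 1) n (int m) - iterate_modes v u w l (n + 1) (int m))"
    by (simp add: Suc power_int_add_1 W.scale_right_diff_distrib)
  also have "\<dots> = - sW ((-1) powi l) (iterate_modes v u w l n (int (Suc m)))"
  proof -
    have "iterate_modes v u w (l + 1) n (int m) - iterate_modes v u w l (n + 1) (int m)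
        = - iterate_modes v u w l n (int (Suc m))"
      using rec[of v u l n "int m"] by (simp add: add.commute)
    thus ?thesis by (simp only: W.scale_minus_right)
  qed
  finally show ?case .
qed

section \<open>The equivalences\<close>

text \<open>
  In a degree \<open>M\<close> in which \<open>opposite_modes\<close> vanishes, the Jacobi identity is the weak identity with
  exponent \<open>M\<close>.
\<close>

lemma jacobi_imp_weak_associativity:
  assumes "jacobi_identity sW Y YW u v w"
  shows "\<exists>N. weak_associativity sW Y YW u v w N"
proof -
  obtain M where "0 \<le> M" "\<forall>m\<ge>M. \<forall>l n. opposite_modes u v w l m n = 0"
    using opposite_modes_eventually_zero by blast
  hence "weak_associativity sW Y YW u v w (nat M)"
    using assms[unfolded jacobi_identity_iff, rule_format, of _ M] by (simp add: weak_associativity_iff)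
  thus ?thesis by blast
qed

lemma jacobi_imp_weak_skew_associativity:
  assumes "jacobi_identity sW Y YW u v w"
  shows "\<exists>N. weak_skew_associativity sW Y YW u v w N"
proof -
  obtain N where "0 \<le> N" "\<forall>n\<ge>N. \<forall>l m. product_modes u v w l m n = 0"
    using product_modes_eventually_zero by blast
  hence "weak_skew_associativity sW Y YW u v w (nat N)"
    using assms[unfolded jacobi_identity_iff, rule_format, of _ _ N] by (simp add: weak_skew_associativity_iff)
  thus ?thesis by blast
qed

lemma weak_skew_associativity_iff_weak_associativity:
  assumes "\<And>a. jacobi_identity sW Y YW a vac w" "\<And>a. jacobi_identity sW Y YW vac a w"
  shows "weak_skew_associativity sW Y YW u v w N \<longleftrightarrow> weak_associativity sW Y YW v u w N"
proof -
  have "iterate_modes u v w l m (int N) = - sW ((-1) powi l) (iterate_modes v u w l (int N) m)" for l m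
  proof -
    have "((-1) powi l :: complex) * (-1) powi l = 1"
      by (simp flip: power_int_mult_distrib)
    thus ?thesis
      using iterate_modes_antisymmetric[OF assms, of v u l N m] by simp
  qed
  thus ?thesis
    unfolding weak_skew_associativity_iff weak_associativity_iff opposite_modes_def by auto
qed

lemma weak_associativities_imp_jacobi:
  assumes "weak_associativity sW Y YW u v w N" and "weak_skew_associativity sW Y YW u v w N'"
  shows "jacobi_identity sW Y YW u v w"
proof -
  obtain M where M: "\<And>l m n. M \<le> m \<Longrightarrow> jacobi_defect u v w l m n = 0"
    using jacobi_defect_weak_associativity[OF assms(1)] by blast
  obtain M' where M': "\<And>l m n. M' \<le> n \<Longrightarrow> jacobi_defect u v w l m n = 0"
    using jacobi_defect_weak_skew_associativity[OF assms(2)] by blast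
  show ?thesis
    unfolding jacobi_identity_iff_defect
    using delta_recursion_vanish_mn[OF delta_recursion_jacobi_defect M M'] by simp
qed

lemma weak_associativity_imp_jacobi:
  assumes assoc: "\<And>u v w. \<exists>N. weak_associativity sW Y YW u v w N"
  shows "jacobi_identity sW Y YW u v w"
proof -
  have vac: "jacobi_identity sW Y YW a b w" if "a = vac \<or> b = vac" for a b
    using jacobi_identity_vacuum[OF that] assoc by blast
  have "\<exists>N. weak_skew_associativity sW Y YW u v w N"
    using assoc[of v u w] by (simp add: weak_skew_associativity_iff_weak_associativity vac)
  thus ?thesis using assoc weak_associativities_imp_jacobi by blast
qed

lemma weak_skew_associativity_imp_jacobi:
  assumes skew: "\<And>u v w. \<exists>N. weak_skew_associativity sW Y YW u v w N"
  shows "jacobi_identity sW Y YW u v w"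
proof -
  have vac: "jacobi_identity sW Y YW a b w" if "a = vac \<or> b = vac" for a b
    using jacobi_identity_vacuum[OF that] skew by blast
  have "\<exists>N. weak_associativity sW Y YW u v w N"
    using skew[of v u w] by (simp add: weak_skew_associativity_iff_weak_associativity vac)
  thus ?thesis using skew weak_associativities_imp_jacobi by blast
qed

end

theorem theorem7p1:
  fixes sV :: "complex \<Rightarrow> 'v \<Rightarrow> 'v::ab_group_add"
    and Y :: "'v \<Rightarrow> int \<Rightarrow> 'v \<Rightarrow> 'v" and vac :: 'v
    and sW :: "complex \<Rightarrow> 'w \<Rightarrow> 'w::ab_group_add"
    and YW :: "'v \<Rightarrow> int \<Rightarrow> 'w \<Rightarrow> 'w"
  assumes "vertex_algebra sV Y vac"
    and "module_minor_axioms sV Y vac sW YW"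
  shows "((\<forall>u v w. jacobi_identity sW Y YW u v w)
            \<longleftrightarrow> (\<forall>u v w. \<exists>m::nat. weak_associativity sW Y YW u v w m))
       \<and> ((\<forall>u v w. jacobi_identity sW Y YW u v w)
            \<longleftrightarrow> (\<forall>u v w. \<exists>m::nat. weak_skew_associativity sW Y YW u v w m))"
proof -
  interpret module_minor_axioms sV Y vac sW YW by fact
  show ?thesis
    using jacobi_imp_weak_associativity jacobi_imp_weak_skew_associativity
      weak_associativity_imp_jacobi weak_skew_associativity_imp_jacobi by blast
qed

end
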